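(* Let $X$ be a Banach space and $\kappa$ an infinite cardinal. The following statements hold: (a) $X$ has the SD2P$_{<\kappa}$ if and only if $X^*$ is $(<\kappa)$-octahedral; (b) $X^*$ has the weak$^*$ SD2P$_{<\kappa}$ if and only if for every set $A\subset S_X$ of cardinality strictly smaller than $\kappa$ and every $\varepsilon>0$ there is $x^{**}\in S_{X^{**}}$ such that $\|x+x^{**}\|\ge 2-\varepsilon$ for every $x\in A$.
   Context: Banach spaces are real and infinite-dimensional. $S_X$ is the unit sphere of $X$ and $X^*$ the topological dual; $X$ is regarded as a subspace of $X^{**}$ canonically. For a normed space $X$, $B\subset X$, $A\subset X^*$ and $\lambda\in(0,1)$, $B$ $\lambda$-norms $A$ if for every $x^*\in A$ there is $x\in B\setminus\{0\}$ with $x^*(x)\ge\lambda\|x^*\|\|x\|$. For a subspace $Y\subset X^*$ and an infinite cardinal $\kappa$, the couple $(X,Y)$ has the SD2P$_{<\kappa}$ if for every set $A\subset S_Y$ of cardinality strictly smaller than $\kappa$ and every $\lambda\in(0,1)$ there are $B\subset S_X$ and $x^*\in S_{X^*}$ such that $B$ $\lambda$-norms $A$ and $x^*(x)\ge\lambda$ for every $x\in B$. $X$ has the SD2P$_{<\kappa}$ if the couple $(X,X^* )$ has it; $X^*$ has the weak$^*$ SD2P$_{<\kappa}$ if the couple $(X^*,X)$ has it. A normed space $Z$ is $(<\kappa)$-octahedral, for $\kappa$ uncountable, if for every subspace $Y\subset Z$ of density character strictly smaller than $\kappa$ and every $\varepsilon>0$ there is $z\in S_Z$ such that $\|y+\lambda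 z\|\ge(1-\varepsilon)(\|y\|+|\lambda|)$ for every $y\in Y$ and $\lambda\in\mathbb R$. For $\kappa=\omega$, $(<\omega)$-octahedral means octahedral, i.e. the same condition with $Y$ ranging over the finite-dimensional subspaces of $Z$. *)

theory Defs
  imports "HOL-Analysis.Analysis"
begin

unbundle cardinal_syntax

text \<open>
  The topological dual of \<open>'a\<close> is \<open>'a \<Rightarrow>\<^sub>L real\<close>. Cardinals are well-orders
  \<open>\<kappa> :: 'k rel\<close> with \<open>Card_order \<kappa>\<close> on an arbitrary type \<open>'k\<close>; \<open><o\<close> compares cardinals
  living on different types, and \<open>natLeq\<close> is the cardinal \<open>\<omega>\<close>.
\<close>

definition finite_dim :: "'a::real_vector set \<Rightarrow> bool" where
  "finite_dim Y \<longleftrightarrow> (\<exists>B. finite B \<and> span B = Y)"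

definition dense_subset :: "'a::topological_space set \<Rightarrow> 'a set \<Rightarrow> bool" where
  "dense_subset D Y \<longleftrightarrow> D \<subseteq> Y \<and> Y \<subseteq> closure D"

text \<open>
  The least cardinality of a dense subset. The choice is of a dense subset of least cardinality,
  so a different choice gives an order-isomorphic cardinal.
\<close>
definition density_character :: "'a::topological_space set \<Rightarrow> 'a rel" where
  "density_character Y = |SOME D. dense_subset D Y \<and> (\<forall>E. dense_subset E Y \<longrightarrow> |D| \<le>o |E| )|"

lemma least_dense_subset_exists:
  "\<exists>D. dense_subset D Y \<and> (\<forall>E. dense_subset E Y \<longrightarrow> |D| \<le>o |E| )"
proof -
  let ?R = "card_of ` {D. dense_subset D Y}"
  have "Y \<in> {D. dense_subset D Y}"
    by (simp add: dense_subset_def closure_subset)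
  then have "?R \<noteq> {}" by blast
  moreover have "\<forall>r\<in>?R. Card_order r" using card_of_Card_order by blast
  ultimately have "\<exists>r\<in>?R. \<forall>r'\<in>?R. r \<le>o r'"
    by (rule exists_minim_Card_order)
  then show ?thesis by simp
qed

lemma density_character_ordLess_iff:
  "density_character Y <o \<kappa> \<longleftrightarrow> (\<exists>D. dense_subset D Y \<and> |D| <o \<kappa>)"
proof -
  let ?P = "\<lambda>D. dense_subset D Y \<and> (\<forall>E. dense_subset E Y \<longrightarrow> |D| \<le>o |E| )"
  have P: "?P (SOME D. ?P D)" by (rule someI_ex[OF least_dense_subset_exists])
  then show ?thesis
    unfolding density_character_def by (meson ordLeq_ordLess_trans)
qed

definition norming :: "real \<Rightarrow> 'a::real_normed_vector set \<Rightarrow> ('a \<Rightarrow>\<^sub>L real) set \<Rightarrow> bool" where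
  "norming l B A \<longleftrightarrow> (\<forall>f\<in>A. \<exists>x\<in>B - {0}. blinfun_apply f x \<ge> l * norm f * norm x)"

text \<open>
  The space \<open>X\<close> of the couple \<open>(X, Y)\<close> is the type \<open>'a\<close>, and \<open>Y\<close> is a subspace of its dual.
\<close>
definition couple_SD2P_lt :: "'k rel \<Rightarrow> ('a::real_normed_vector \<Rightarrow>\<^sub>L real) set \<Rightarrow> bool" where
  "couple_SD2P_lt \<kappa> Y \<longleftrightarrow>
    (\<forall>A l. A \<subseteq> sphere 0 1 \<inter> Y \<longrightarrow> |A| <o \<kappa> \<longrightarrow> 0 < l \<longrightarrow> l < 1 \<longrightarrow>
      (\<exists>B f. B \<subseteq> sphere 0 1 \<and> f \<in> sphere 0 1 \<and> norming l B A \<and>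
        (\<forall>x\<in>B. blinfun_apply f x \<ge> l)))"

definition canonical_embedding :: "'a::real_normed_vector \<Rightarrow> (('a \<Rightarrow>\<^sub>L real) \<Rightarrow>\<^sub>L real)" where
  "canonical_embedding x = Blinfun (\<lambda>f. blinfun_apply f x)"

lemma canonical_embedding_apply [simp]:
  "blinfun_apply (canonical_embedding x) f = blinfun_apply f x"
  by (simp add: canonical_embedding_def bounded_linear_Blinfun_apply)

lemma subspace_range_canonical_embedding: "subspace (range canonical_embedding)"
proof -
  have "linear (canonical_embedding :: 'a \<Rightarrow> _)"
    by (intro linearI blinfun_eqI) (simp_all add: blinfun.bilinear_simps)
  then show ?thesis by (simp add: linear_subspace_image)
qed

definition SD2P_lt :: "'k rel \<Rightarrow> 'a::real_normed_vector itself \<Rightarrow> bool" where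
  "SD2P_lt \<kappa> _ \<longleftrightarrow> couple_SD2P_lt \<kappa> (UNIV :: ('a \<Rightarrow>\<^sub>L real) set)"

text \<open>The type argument is \<open>X\<close>; the property is one of its dual, namely of the couple \<open>(X\<^sup>*, X)\<close>.\<close>
definition dual_weak_star_SD2P_lt :: "'k rel \<Rightarrow> 'a::real_normed_vector itself \<Rightarrow> bool" where
  "dual_weak_star_SD2P_lt \<kappa> _ \<longleftrightarrow> couple_SD2P_lt \<kappa> (range (canonical_embedding :: 'a \<Rightarrow> _))"

text \<open>
  An infinite \<open>\<kappa>\<close> is uncountable if \<open>natLeq <o \<kappa>\<close>; the other case is \<open>\<kappa> = \<omega>\<close>, where
  \<open>octahedral_lt\<close> is plain octahedrality.
\<close>
definition octahedral_lt :: "'k rel \<Rightarrow> 'z::real_normed_vector itself \<Rightarrow> bool" where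
  "octahedral_lt \<kappa> _ \<longleftrightarrow>
    (\<forall>(Y :: 'z set) e. subspace Y \<longrightarrow>
      (if natLeq <o \<kappa> then density_character Y <o \<kappa> else finite_dim Y) \<longrightarrow> e > 0 \<longrightarrow>
      (\<exists>z\<in>sphere 0 1. \<forall>y\<in>Y. \<forall>t::real. norm (y + t *\<^sub>R z) \<ge> (1 - e) * (norm y + \<bar>t\<bar>)))"

end

theory Submission
  imports Defs
begin

text \<open>
  Both equivalences come from one reading of the SD2P. If a unit vector \<open>x\<close> of \<open>X\<close> satisfies
  \<open>g x \<ge> \<lambda>\<close> and \<open>f x \<ge> \<lambda>\<close> for unit functionals \<open>f\<close> and \<open>g\<close>, then \<open>\<parallel>g + f\<parallel> \<ge> 2 * \<lambda>\<close>; conversely,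
  if \<open>\<parallel>g + f\<parallel>\<close> is close to 2, then a unit vector at which \<open>g + f\<close> nearly attains its norm makes
  both \<open>g x\<close> and \<open>f x\<close> close to 1. A couple \<open>(X, Y)\<close> therefore has the SD2P below \<open>\<kappa>\<close> exactly
  when any fewer than \<open>\<kappa>\<close> unit vectors \<open>g\<close> of \<open>Y\<close> admit, for each \<open>e > 0\<close>, a common unit
  functional \<open>f\<close> with \<open>\<parallel>g + f\<parallel> \<ge> 2 - e\<close> (lemma \<open>couple_SD2P_lt_iff\<close>).

  For the weak-star statement the couple is \<open>(X\<^sup>*, X)\<close>, and it only remains to know that the unit
  vectors of \<open>X\<close> are the unit vectors of its image in the bidual. This is the Hahn--Banach theorem.
  It is obtained here from a minimal sublinear functional below the norm, because such a functional
  is automatically linear.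

  For the first statement, the condition on sets of unit vectors has to be compared with the
  octahedral inequality on subspaces (lemma \<open>octahedral_lt_iff\<close>). From subspaces to sets, the span
  of fewer than \<open>\<kappa>\<close> vectors is small enough: it is finite-dimensional for finitely many vectors, and
  for uncountable \<open>\<kappa>\<close> its rational combinations form a dense subset of size below \<open>\<kappa>\<close>. From sets
  to subspaces, the unit sphere of \<open>Y\<close> has an approximating set of size below \<open>\<kappa>\<close>: a dense set for
  uncountable \<open>\<kappa>\<close>, a finite net for \<open>\<kappa> = \<omega>\<close>. A direction that works for the normalized
  approximating vectors works, with a slightly larger error, for all unit vectors of \<open>Y\<close>, and
  then by the triangle inequality for all multiples.
\<close>

section \<open>Hahn--Banach: the canonical embedding is isometric\<close>

definition sublinear :: "('a::real_vector \<Rightarrow> real) \<Rightarrow> bool" where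
  "sublinear p \<longleftrightarrow> (\<forall>x y. p (x + y) \<le> p x + p y) \<and> (\<forall>c x. 0 \<le> c \<longrightarrow> p (c *\<^sub>R x) = c * p x)"

lemma sublinear_add: "sublinear p \<Longrightarrow> p (x + y) \<le> p x + p y"
  and sublinear_scale: "sublinear p \<Longrightarrow> 0 \<le> c \<Longrightarrow> p (c *\<^sub>R x) = c * p x"
  by (auto simp: sublinear_def)

lemma sublinear_zero: "sublinear p \<Longrightarrow> p 0 = 0"
  using sublinear_scale[of p 0 0] by simp

lemma sublinear_minus: "sublinear p \<Longrightarrow> - p (- x) \<le> p x"
  using sublinear_add[of p x "- x"] sublinear_zero[of p] by simp

text \<open>
  The largest sublinear functional below \<open>p\<close> whose value at \<open>- y\<close> is at most \<open>- p y\<close>. It lowers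
  \<open>p\<close> unless \<open>p\<close> is already additive along the line through \<open>y\<close>.
\<close>
definition sublinear_descent :: "('a::real_vector \<Rightarrow> real) \<Rightarrow> 'a \<Rightarrow> 'a \<Rightarrow> real" where
  "sublinear_descent p y x = (INF t\<in>{0..}. p (x + t *\<^sub>R y) - t * p y)"

lemma sublinear_descent_lower_bound:
  assumes "sublinear p" "0 \<le> t"
  shows "- p (- x) \<le> p (x + t *\<^sub>R y) - t * p y"
  using sublinear_add[OF assms(1), of "x + t *\<^sub>R y" "- x"] sublinear_scale[OF assms, of y]
  by simp

lemma sublinear_descent_le:
  assumes "sublinear p" "0 \<le> t"
  shows "sublinear_descent p y x \<le> p (x + t *\<^sub>R y) - t * p y"
  unfolding sublinear_descent_def
proof (rule cINF_lower)
  show "bdd_below ((\<lambda>t. p (x + t *\<^sub>R y) - t * p y) ` {0..})"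
    using sublinear_descent_lower_bound[OF assms(1)] by (intro bdd_belowI2[where m="- p (- x)"]) auto
qed (use assms in simp)

lemma sublinear_descent_greatest:
  assumes "\<And>t. 0 \<le> t \<Longrightarrow> m \<le> p (x + t *\<^sub>R y) - t * p y"
  shows "m \<le> sublinear_descent p y x"
  unfolding sublinear_descent_def using assms by (intro cINF_greatest) auto

lemma sublinear_descent_le_self: "sublinear p \<Longrightarrow> sublinear_descent p y x \<le> p x"
  using sublinear_descent_le[of p 0 y x] by simp

lemma sublinear_descent_minus: "sublinear p \<Longrightarrow> sublinear_descent p y (- y) \<le> - p y"
  using sublinear_descent_le[of p 1 y "- y"] by (simp add: sublinear_zero)

text \<open>
  Subadditivity holds because the parameters \<open>s\<close> and \<open>t\<close> chosen for two vectors can be added, and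
  homogeneity because a positive factor \<open>c\<close> only rescales the parameter from \<open>t\<close> to \<open>c * t\<close>.
\<close>
lemma sublinear_sublinear_descent:
  assumes p: "sublinear p"
  shows "sublinear (sublinear_descent p y)"
  unfolding sublinear_def
proof (intro conjI allI impI)
  let ?q = "sublinear_descent p y"
  fix u v
  have "?q (u + v) - (p (u + s *\<^sub>R y) - s * p y) \<le> p (v + t *\<^sub>R y) - t * p y"
    if "0 \<le> s" "0 \<le> t" for s t
  proof -
    have "?q (u + v) \<le> p ((u + v) + (s + t) *\<^sub>R y) - (s + t) * p y"
      using that by (intro sublinear_descent_le p) auto
    also have "(u + v) + (s + t) *\<^sub>R y = (u + s *\<^sub>R y) + (v + t *\<^sub>R y)"
      by (simp add: algebra_simps)
    finally show ?thesis
      using sublinear_add[OF p, of "u + s *\<^sub>R y" "v + t *\<^sub>R y"] by (simp add: algebra_simps)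
  qed
  then have "?q (u + v) - (p (u + s *\<^sub>R y) - s * p y) \<le> ?q v" if "0 \<le> s" for s
    using that by (intro sublinear_descent_greatest) auto
  then have "?q (u + v) - ?q v \<le> p (u + s *\<^sub>R y) - s * p y" if "0 \<le> s" for s
    using that by fastforce
  then have "?q (u + v) - ?q v \<le> ?q u"
    by (intro sublinear_descent_greatest) auto
  then show "?q (u + v) \<le> ?q u + ?q v" by simp
next
  let ?q = "sublinear_descent p y"
  have q0: "?q 0 = 0"
  proof (rule antisym)
    show "?q 0 \<le> 0" using sublinear_descent_le_self[OF p, of y 0] sublinear_zero[OF p] by simp
    show "0 \<le> ?q 0" using sublinear_descent_lower_bound[OF p, of _ 0 y] sublinear_zero[OF p]
      by (intro sublinear_descent_greatest) auto
  qed
  have le: "?q (c *\<^sub>R x) \<le> c * ?q x" if c: "0 < c" for c x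
  proof -
    have "?q (c *\<^sub>R x) / c \<le> p (x + t *\<^sub>R y) - t * p y" if "0 \<le> t" for t
    proof -
      have "?q (c *\<^sub>R x) \<le> p (c *\<^sub>R x + (c * t) *\<^sub>R y) - (c * t) * p y"
        using that c by (intro sublinear_descent_le p) auto
      also have "c *\<^sub>R x + (c * t) *\<^sub>R y = c *\<^sub>R (x + t *\<^sub>R y)"
        by (simp add: algebra_simps)
      finally show ?thesis
        using c sublinear_scale[OF p, of c "x + t *\<^sub>R y"] by (simp add: field_simps)
    qed
    then have "?q (c *\<^sub>R x) / c \<le> ?q x" by (intro sublinear_descent_greatest)
    then show ?thesis using c by (simp add: field_simps)
  qed
  fix c :: real and x
  assume "0 \<le> c"
  show "?q (c *\<^sub>R x) = c * ?q x"
  proof (cases "c = 0")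
    case False
    with \<open>0 \<le> c\<close> have c: "0 < c" by simp
    have "?q (inverse c *\<^sub>R (c *\<^sub>R x)) \<le> inverse c * ?q (c *\<^sub>R x)"
      using c by (intro le) simp
    then have "c * ?q x \<le> ?q (c *\<^sub>R x)" using c by (simp add: field_simps)
    then show ?thesis using le[OF c, of x] by simp
  qed (simp add: q0)
qed

text \<open>
  The descent along \<open>y\<close> cannot lower a minimal \<open>q\<close>, which forces \<open>q (- y) = - q y\<close>. A sublinear
  functional that is odd is linear.
\<close>
lemma linear_if_minimal_sublinear:
  assumes q: "sublinear q"
    and minimal: "\<And>r. sublinear r \<Longrightarrow> r \<le> q \<Longrightarrow> r = q"
  shows "linear q"
proof -
  have "sublinear_descent q y = q" for y
    using sublinear_sublinear_descent[OF q] sublinear_descent_le_self[OF q]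
    by (intro minimal) (auto simp: le_fun_def)
  then have minus: "q (- y) = - q y" for y
    using sublinear_descent_minus[OF q, of y] sublinear_minus[OF q, of y] by simp
  show ?thesis
  proof (rule linearI)
    fix x y
    have "q x \<le> q (x + y) - q y"
      using sublinear_add[OF q, of "x + y" "- y"] minus[of y] by simp
    then show "q (x + y) = q x + q y" using sublinear_add[OF q, of x y] by simp
  next
    fix c :: real and x
    show "q (c *\<^sub>R x) = c *\<^sub>R q x"
      using sublinear_scale[OF q, of c x] sublinear_scale[OF q, of "- c" x] minus[of "c *\<^sub>R x"]
      by (cases "0 \<le> c") auto
  qed
qed

text \<open>
  Zorn's lemma gives a minimal sublinear functional below \<open>p\<close>: the pointwise infimum of a chain is
  finite, since every sublinear \<open>r \<le> p\<close> satisfies \<open>- p (- x) \<le> r x\<close>, and it is again sublinear.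
\<close>
lemma exists_linear_le_sublinear:
  fixes p :: "'a::real_vector \<Rightarrow> real"
  assumes p: "sublinear p"
  shows "\<exists>f. linear f \<and> f \<le> p"
proof -
  let ?S = "{q. sublinear q \<and> q \<le> p}"
  have "\<exists>q\<in>?S. \<forall>r\<in>?S. r \<le> q \<longrightarrow> r = q"
  proof (rule predicate_Zorn[of ?S "\<lambda>a b. b \<le> a"])
    show "partial_order_on ?S (relation_of (\<lambda>a b. b \<le> a) ?S)"
      by (rule partial_order_on_relation_ofI) auto
  next
    fix C assume C: "C \<in> Chains (relation_of (\<lambda>a b. b \<le> a) ?S)"
    then have CS: "sublinear r" "r \<le> p" if "r \<in> C" for r
      using that Chains_relation_of by blast+
    have chain: "r \<le> s \<or> s \<le> r" if "r \<in> C" "s \<in> C" for r s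
      using C that by (auto simp: Chains_def relation_of_def)
    show "\<exists>u\<in>?S. \<forall>a\<in>C. u \<le> a"
    proof (cases "C = {}")
      case True
      then show ?thesis using p by auto
    next
      case False
      define u where "u x = (INF r\<in>C. r x)" for x
      have bdd: "bdd_below ((\<lambda>r. r x) ` C)" for x
      proof (rule bdd_belowI2)
        fix r assume r: "r \<in> C"
        then have "r (- x) \<le> p (- x)" using CS(2) by (simp add: le_fun_def)
        then show "- p (- x) \<le> r x" using sublinear_minus[OF CS(1)[OF r], of x] by simp
      qed
      have u_le: "u x \<le> r x" if "r \<in> C" for r x
        unfolding u_def using bdd that by (rule cINF_lower)
      have u_ge: "m \<le> u x" if "\<And>r. r \<in> C \<Longrightarrow> m \<le> r x" for m x
        unfolding u_def using False that by (intro cINF_greatest)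
      have "u (x + y) - r x \<le> s y" if r: "r \<in> C" and s: "s \<in> C" for x y r s
      proof -
        \<comment> \<open>The smaller of two members of the chain is subadditive, and it bounds both from below.\<close>
        obtain t where t: "t \<in> C" "t \<le> r" "t \<le> s" using chain[OF r s] r s by blast
        have "u (x + y) \<le> t x + t y"
          using u_le[OF t(1), of "x + y"] sublinear_add[OF CS(1)[OF t(1)], of x y] by simp
        also have "\<dots> \<le> r x + s y" using t by (intro add_mono) (auto simp: le_fun_def)
        finally show ?thesis by simp
      qed
      then have "u (x + y) - r x \<le> u y" if "r \<in> C" for x y r
        using that by (intro u_ge)
      then have "u (x + y) - u y \<le> r x" if "r \<in> C" for x y r
        using that by (metis diff_le_eq add.commute)
      then have "u (x + y) - u y \<le> u x" for x y by (intro u_ge)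
      then have add: "u (x + y) \<le> u x + u y" for x y by (simp add: diff_le_eq)
      have scale: "u (c *\<^sub>R x) = c * u x" if "0 \<le> c" for c x
      proof -
        have "u (c *\<^sub>R x) = (INF r\<in>C. c * r x)"
          unfolding u_def using CS(1) that by (intro INF_cong) (auto simp: sublinear_scale)
        also have "\<dots> = c * u x"
        proof (rule antisym)
          show "(INF r\<in>C. c * r x) \<le> c * u x"
          proof (cases "c = 0")
            case True
            then show ?thesis using False by simp
          next
            case c: False
            have "bdd_below ((\<lambda>r. c * r x) ` C)"
              using u_le that by (intro bdd_belowI2[where m="c * u x"] mult_left_mono)
            then have "(INF r\<in>C. c * r x) \<le> c * r x" if "r \<in> C" for r
              using that by (rule cINF_lower)
            then have "(INF r\<in>C. c * r x) / c \<le> u x"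
              using c that by (intro u_ge) (auto simp: field_simps)
            then show ?thesis using c that by (simp add: field_simps)
          qed
          show "c * u x \<le> (INF r\<in>C. c * r x)"
            using False u_le that by (intro cINF_greatest mult_left_mono)
        qed
        finally show ?thesis .
      qed
      obtain r where r: "r \<in> C" using False by blast
      have "sublinear u" using add scale by (simp add: sublinear_def)
      moreover have "u \<le> p"
        using u_le[OF r] CS(2)[OF r] by (auto simp: le_fun_def intro: order_trans)
      ultimately show ?thesis using u_le by (auto simp: le_fun_def)
    qed
  qed
  then obtain q where q: "sublinear q" "q \<le> p"
    and minimal: "\<And>r. sublinear r \<Longrightarrow> r \<le> p \<Longrightarrow> r \<le> q \<Longrightarrow> r = q"
    by auto
  have "linear q"
    using q minimal by (intro linear_if_minimal_sublinear) (auto intro: order_trans)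
  then show ?thesis using q by blast
qed

text \<open>
  A linear functional below the descent of the norm along \<open>x\<close>, rather than below the norm itself,
  is at most \<open>- norm x\<close> at \<open>- x\<close>, so it attains the value \<open>norm x\<close> at \<open>x\<close>.
\<close>
lemma exists_norming_functional:
  fixes x :: "'a::real_normed_vector"
  shows "\<exists>f :: 'a \<Rightarrow>\<^sub>L real. norm f \<le> 1 \<and> blinfun_apply f x = norm x"
proof -
  have n: "sublinear (norm :: 'a \<Rightarrow> real)"
    by (simp add: sublinear_def norm_triangle_ineq)
  let ?p = "sublinear_descent norm x"
  obtain f where f: "linear f" "f \<le> ?p"
    using exists_linear_le_sublinear[OF sublinear_sublinear_descent[OF n]] by blast
  have f_le: "f y \<le> norm y" for y
    using f(2) sublinear_descent_le_self[OF n, of x y] by (auto simp: le_fun_def intro: order_trans)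
  have abs_le: "\<bar>f y\<bar> \<le> norm y" for y
    using f_le[of y] f_le[of "- y"] linear_neg[OF f(1), of y] by simp
  have "f (- x) \<le> - norm x"
    using f(2) sublinear_descent_minus[OF n, of x] by (auto simp: le_fun_def intro: order_trans)
  then have fx: "f x = norm x"
    using linear_neg[OF f(1), of x] f_le[of x] by simp
  have bl: "bounded_linear f"
    using f(1) abs_le
    by (intro bounded_linear_intro[where K=1]) (auto simp: linear_add linear_scale)
  have "norm (Blinfun f) \<le> 1"
    using abs_le by (intro norm_blinfun_bound) (auto simp: bounded_linear_Blinfun_apply[OF bl])
  then show ?thesis
    using fx by (intro exI[of _ "Blinfun f"]) (simp add: bounded_linear_Blinfun_apply[OF bl])
qed

lemma norm_canonical_embedding [simp]: "norm (canonical_embedding x) = norm x"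
proof (rule antisym)
  show "norm (canonical_embedding x) \<le> norm x"
  proof (rule norm_blinfun_bound)
    fix f :: "'a \<Rightarrow>\<^sub>L real"
    show "norm (blinfun_apply (canonical_embedding x) f) \<le> norm x * norm f"
      using norm_blinfun[of f x] by (simp add: mult.commute)
  qed simp
  obtain f :: "'a \<Rightarrow>\<^sub>L real" where f: "norm f \<le> 1" "blinfun_apply f x = norm x"
    using exists_norming_functional by blast
  have "norm x \<le> norm (canonical_embedding x) * norm f"
    using norm_blinfun[of "canonical_embedding x" f] f(2) by simp
  also have "\<dots> \<le> norm (canonical_embedding x)"
    using f(1) by (simp add: mult_left_le)
  finally show "norm x \<le> norm (canonical_embedding x)" .
qed

section \<open>The SD2P of a couple in terms of norms of sums\<close>

text \<open>
  For \<open>Y = UNIV\<close> this is octahedrality tested on small sets of unit vectors instead of subspaces;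
  restricting the vectors to \<open>Y\<close> gives the property matching the SD2P of a couple.
\<close>
definition additive_direction_lt :: "'k rel \<Rightarrow> 'z::real_normed_vector set \<Rightarrow> bool" where
  "additive_direction_lt \<kappa> Y \<longleftrightarrow>
    (\<forall>A e. A \<subseteq> sphere 0 1 \<inter> Y \<longrightarrow> |A| <o \<kappa> \<longrightarrow> 0 < e \<longrightarrow>
      (\<exists>z\<in>sphere 0 1. \<forall>x\<in>A. 2 - e \<le> norm (x + z)))"

lemma exists_unit_vector_above:
  fixes f :: "'a::real_normed_vector \<Rightarrow>\<^sub>L real"
  assumes "0 \<le> c" "c < norm f"
  shows "\<exists>x\<in>sphere 0 1. c \<le> blinfun_apply f x"
proof -
  have "\<exists>x. c * norm x < norm (blinfun_apply f x)"
    using norm_blinfun_bound[OF assms(1), of f] assms(2) by (meson not_le)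
  then obtain x where x: "c * norm x < \<bar>blinfun_apply f x\<bar>" by auto
  then have x0: "x \<noteq> 0" by (auto simp: blinfun.zero_right)
  let ?y = "(sgn (blinfun_apply f x) / norm x) *\<^sub>R x"
  have "blinfun_apply f x \<noteq> 0" using x assms(1) by (smt (verit) mult_nonneg_nonneg norm_ge_zero)
  then have "norm ?y = 1" using x0 by (simp add: abs_sgn_eq)
  moreover have "c \<le> blinfun_apply f ?y"
    using x x0 by (simp add: blinfun.scaleR_right field_simps abs_sgn)
  ultimately show ?thesis by (intro bexI[of _ ?y]) auto
qed

text \<open>
  A norming set \<open>B\<close> that \<open>f\<close> keeps above \<open>l\<close> is the same as one unit vector for each \<open>g\<close> at which
  both \<open>f\<close> and \<open>g\<close> are at least \<open>l\<close>. Such vectors exist precisely when \<open>norm (g + f)\<close> is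
  close to 2.
\<close>
lemma couple_SD2P_lt_iff:
  "couple_SD2P_lt \<kappa> Y \<longleftrightarrow> additive_direction_lt \<kappa> Y"
proof
  assume L: "couple_SD2P_lt \<kappa> Y"
  show "additive_direction_lt \<kappa> Y"
    unfolding additive_direction_lt_def
  proof (intro allI impI)
    fix A and e :: real
    assume A: "A \<subseteq> sphere 0 1 \<inter> Y" "|A| <o \<kappa>" and e: "0 < e"
    \<comment> \<open>Capping e at 1 keeps l positive when e is large.\<close>
    define l where "l = 1 - min e 1 / 2"
    have l: "0 < l" "l < 1" "2 - e \<le> 2 * l" using e by (auto simp: l_def min_def)
    obtain B f where B: "B \<subseteq> sphere 0 1" and f: "f \<in> sphere 0 1"
      and nrm: "norming l B A" and fB: "\<forall>x\<in>B. l \<le> blinfun_apply f x"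
      using L A l(1,2) unfolding couple_SD2P_lt_def by meson
    have "2 - e \<le> norm (g + f)" if g: "g \<in> A" for g
    proof -
      obtain x where x: "x \<in> B" "l * norm g * norm x \<le> blinfun_apply g x"
        using nrm g by (auto simp: norming_def)
      have "norm x = 1" "norm g = 1" using x B g A by auto
      then have "2 * l \<le> blinfun_apply (g + f) x"
        using x fB by (auto simp: blinfun.add_left)
      also have "\<dots> \<le> norm (g + f)"
        using norm_blinfun[of "g + f" x] \<open>norm x = 1\<close> by simp
      finally show ?thesis using l by simp
    qed
    then show "\<exists>z\<in>sphere 0 1. \<forall>x\<in>A. 2 - e \<le> norm (x + z)" using f by blast
  qed
next
  assume R: "additive_direction_lt \<kappa> Y"
  show "couple_SD2P_lt \<kappa> Y"
    unfolding couple_SD2P_lt_def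
  proof (intro allI impI)
    fix A and l :: real
    assume A: "A \<subseteq> sphere 0 1 \<inter> Y" "|A| <o \<kappa>" and l: "0 < l" "l < 1"
    obtain f where f: "f \<in> sphere 0 1" and far: "\<And>g. g \<in> A \<Longrightarrow> 2 - (1 - l) / 2 \<le> norm (g + f)"
      using R A l unfolding additive_direction_lt_def by (metis diff_gt_0_iff_gt half_gt_zero)
    \<comment> \<open>The largest admissible B: the slice of the unit sphere cut out by f.\<close>
    define B where "B = {x \<in> sphere 0 1. l \<le> blinfun_apply f x}"
    have "\<exists>x\<in>B - {0}. l * norm g * norm x \<le> blinfun_apply g x" if g: "g \<in> A" for g
    proof -
      \<comment> \<open>Since l < 1, the error (1 - l) / 2 leaves norm (g + f) strictly above 1 + l.\<close>
      obtain x where x: "x \<in> sphere 0 1" "1 + l \<le> blinfun_apply (g + f) x"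
        using exists_unit_vector_above[of "1 + l" "g + f"] far[OF g] l by (auto simp: field_simps)
      have nx: "norm x = 1" and ng: "norm g = 1" using x g A by auto
      have "blinfun_apply g x \<le> 1" "blinfun_apply f x \<le> 1"
        using norm_blinfun[of g x] norm_blinfun[of f x] nx ng f by auto
      then show ?thesis
        using x nx ng by (intro bexI[of _ x]) (auto simp: B_def blinfun.add_left)
    qed
    then have "norming l B A" by (auto simp: norming_def)
    then show "\<exists>B f. B \<subseteq> sphere 0 1 \<and> f \<in> sphere 0 1 \<and> norming l B A \<and>
        (\<forall>x\<in>B. l \<le> blinfun_apply f x)"
      using f by (intro exI[of _ B] exI[of _ f]) (auto simp: B_def)
  qed
qed

section \<open>Dense subsets of spans and finite nets\<close>

text \<open>
  Rational linear combinations of exactly \<open>n\<close> terms, repetitions allowed. The recursion on \<open>n\<close>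
  exhibits each level as the image of a product, which is what bounds its cardinality.
\<close>
primrec rational_combinations :: "'a::real_vector set \<Rightarrow> nat \<Rightarrow> 'a set" where
  "rational_combinations A 0 = {0}"
| "rational_combinations A (Suc n) =
    (\<lambda>(q, a, d). real_of_rat q *\<^sub>R a + d) ` (UNIV \<times> A \<times> rational_combinations A n)"

lemma rational_combinations_subset_span: "rational_combinations A n \<subseteq> span A"
proof (induction n)
  case (Suc n)
  then show ?case by (force intro: span_add span_scale span_base)
qed (simp add: span_zero)

lemma span_subset_closure_rational_combinations:
  fixes A :: "'a::real_normed_vector set"
  shows "span A \<subseteq> closure (\<Union>n. rational_combinations A n)"
proof
  let ?D = "\<Union>n. rational_combinations A n"
  fix x assume "x \<in> span A"
  then show "x \<in> closure ?D"
  proof (induction rule: span_induct_alt)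
    case base
    have "0 \<in> ?D" by (rule UN_I[of 0]) auto
    then show ?case by (rule subsetD[OF closure_subset])
  next
    case (step c a y)
    show ?case
      unfolding closure_approachable
    proof (intro allI impI)
      fix e :: real assume e: "0 < e"
      obtain d where d: "d \<in> ?D" "dist d y < e / 2"
        using step.IH e unfolding closure_approachable by (meson half_gt_zero)
      obtain r where r: "r \<in> \<rat>" "\<bar>r - c\<bar> < e / (2 * (norm a + 1))"
        using rational_approximation[of "e / (2 * (norm a + 1))" c] e
        by (metis add_nonneg_pos divide_pos_pos mult_pos_pos norm_ge_zero zero_less_numeral zero_less_one)
      then obtain q where q: "r = real_of_rat q" by (auto elim: Rats_cases)
      obtain n where "d \<in> rational_combinations A n" using d by auto
      then have "r *\<^sub>R a + d \<in> rational_combinations A (Suc n)"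
        using step.hyps q by (auto simp: image_iff)
      moreover have "dist (r *\<^sub>R a + d) (c *\<^sub>R a + y) < e"
      proof -
        have "dist (r *\<^sub>R a + d) (c *\<^sub>R a + y) = norm ((r - c) *\<^sub>R a + (d - y))"
          by (simp add: dist_norm algebra_simps)
        also have "\<dots> \<le> \<bar>r - c\<bar> * norm a + norm (d - y)"
          by (metis norm_scaleR norm_triangle_ineq)
        also have "\<bar>r - c\<bar> * norm a \<le> e / (2 * (norm a + 1)) * (norm a + 1)"
          using r e by (intro mult_mono) auto
        also have "\<dots> = e / 2" using add_nonneg_pos[of "norm a" 1] by (simp add: field_simps)
        finally show ?thesis using d by (simp add: dist_norm)
      qed
      ultimately show "\<exists>x\<in>?D. dist x (c *\<^sub>R a + y) < e" by blast
    qed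
  qed
qed

text \<open>
  The summand \<open>UNIV :: nat set\<close> makes the bound infinite, so that products with the rationals and
  countable unions do not exceed it.
\<close>
lemma card_of_rational_combinations:
  fixes A :: "'a::real_vector set"
  shows "|\<Union>n. rational_combinations A n| \<le>o |A <+> (UNIV :: nat set)|"
proof -
  let ?U = "A <+> (UNIV :: nat set)"
  have inf: "infinite ?U" by simp
  have nat: "|UNIV :: nat set| \<le>o |?U|" by (rule card_of_Plus2)
  have "|UNIV :: rat set| \<le>o |UNIV :: nat set|"
    using card_of_ordLeq[of "UNIV :: rat set" "UNIV :: nat set"] countableI_type[of "UNIV :: rat set"]
    by (auto simp: countable_def)
  then have rat: "|UNIV :: rat set| \<le>o |?U|" using nat ordLeq_transitive by blast
  have fin: "Card_order |?U|" "infinite (Field |?U| )"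
    using inf card_of_Card_order[of ?U] by (auto simp only: Field_card_of)
  have "|rational_combinations A n| \<le>o |?U|" for n
  proof (induction n)
    case 0
    then show ?case using inf by (simp add: card_of_singl_ordLeq)
  next
    case (Suc n)
    have "|UNIV \<times> A \<times> rational_combinations A n :: (rat \<times> 'a \<times> 'a) set| \<le>o |?U|"
      using Suc fin rat by (intro card_of_Times_ordLeq_infinite_Field) (auto simp: card_of_Plus1)
    then show ?case using card_of_image ordLeq_transitive by fastforce
  qed
  then show ?thesis using inf nat by (intro card_of_UNION_ordLeq_infinite) auto
qed

lemma density_character_span_ordLess:
  fixes A :: "'a::real_normed_vector set"
  assumes "Card_order \<kappa>" "natLeq <o \<kappa>" "|A| <o \<kappa>"
  shows "density_character (span A) <o \<kappa>"
proof -
  let ?D = "\<Union>n. rational_combinations A n"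
  have "natLeq \<le>o |Field \<kappa>|"
    using assms(1,2) card_of_Field_ordIso ordIso_symmetric ordLess_imp_ordLeq ordLeq_ordIso_trans
    by blast
  then have inf: "infinite (Field \<kappa>)" using infinite_iff_natLeq_ordLeq by blast
  have "|UNIV :: nat set| <o \<kappa>"
    using assms(2) card_of_nat ordIso_ordLess_trans by blast
  then have "|A <+> (UNIV :: nat set)| <o \<kappa>"
    using assms inf by (intro card_of_Plus_ordLess_infinite_Field)
  then have "|?D| <o \<kappa>" using card_of_rational_combinations ordLeq_ordLess_trans by blast
  moreover have "dense_subset ?D (span A)"
    using span_subset_closure_rational_combinations rational_combinations_subset_span
    unfolding dense_subset_def by blast
  ultimately show ?thesis unfolding density_character_ordLess_iff by blast
qed

text \<open>
  Compactness of bounded closed sets in finite dimension, in the form of finite nets and without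
  coordinates. Adding a vector \<open>b\<close> to \<open>B\<close> either keeps the span inside the closure of \<open>span B\<close> or
  adds a coordinate that is bounded in terms of the norm.
\<close>
lemma totally_bounded_cball_Int_span:
  fixes B :: "'a::real_normed_vector set"
  assumes "finite B" "0 < e"
  shows "\<exists>F. finite F \<and> (\<forall>y\<in>span B. norm y \<le> r \<longrightarrow> (\<exists>x\<in>F. dist y x < e))"
  using assms
proof (induction B arbitrary: r e rule: finite_induct)
  case empty
  then show ?case by (intro exI[of _ "{0}"]) auto
next
  case (insert b B)
  define d where "d = infdist b (span B)"
  have ne: "span B \<noteq> {}" using span_zero by blast
  show ?case
  proof (cases "d = 0")
    case True
    \<comment> \<open>Here span B is dense in the span of insert b B, so a slightly larger net of it suffices.\<close>
    obtain F where F: "finite F" "\<And>y. y \<in> span B \<Longrightarrow> norm y \<le> r + 1 \<Longrightarrow> \<exists>x\<in>F. dist y x < e / 2"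
      using insert.IH[of "e / 2" "r + 1"] insert.prems by auto
    have "\<exists>x\<in>F. dist y x < e" if y: "y \<in> span (insert b B)" "norm y \<le> r" for y
    proof -
      obtain k where k: "y - k *\<^sub>R b \<in> span B" using y span_breakdown_eq by blast
      let ?h = "min 1 (e / 2)"
      have "b \<in> closure (span B)"
        using True ne by (simp add: d_def in_closure_iff_infdist_zero)
      then obtain w where w: "w \<in> span B" "dist w b < ?h / (\<bar>k\<bar> + 1)"
        using insert.prems unfolding closure_approachable
        by (metis abs_ge_zero add_nonneg_pos divide_pos_pos half_gt_zero min_less_iff_conj zero_less_one)
      let ?y = "(y - k *\<^sub>R b) + k *\<^sub>R w"
      have yB: "?y \<in> span B" using k w by (intro span_add span_scale)
      have "dist y ?y = \<bar>k\<bar> * dist w b"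
        by (metis (no_types, lifting) add_diff_cancel_left' diff_add_eq diff_diff_eq2 dist_commute dist_norm norm_scaleR scaleR_right_diff_distrib)
      also have "\<dots> \<le> (\<bar>k\<bar> + 1) * dist w b" by (simp add: mult_right_mono)
      also have "\<dots> < ?h" using w by (simp add: field_simps)
      finally have dy: "dist y ?y < ?h" .
      have "norm ?y \<le> r + 1"
        using dy y(2) norm_triangle_ineq2[of ?y y] by (simp add: dist_norm norm_minus_commute)
      then obtain x where x: "x \<in> F" "dist ?y x < e / 2" using F(2) yB by blast
      have "dist y x < e" using dy x dist_triangle[of y x ?y] by simp
      then show ?thesis using x by blast
    qed
    then show ?thesis using F(1) by blast
  next
    case False
    then have d: "0 < d" using infdist_nonneg[of b "span B"] by (simp add: d_def)
    \<comment> \<open>The distance d bounds the b-coordinate of a vector by its norm, and hence its span B part.\<close>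
    let ?S = "(\<lambda>s. s *\<^sub>R b) ` {- \<bar>r\<bar> / d .. \<bar>r\<bar> / d}"
    have "compact ?S" by (intro compact_continuous_image continuous_intros compact_Icc)
    then obtain G where G: "finite G" "?S \<subseteq> (\<Union>x\<in>G. ball x (e / 2))"
      using insert.prems unfolding compact_eq_totally_bounded by (meson half_gt_zero)
    obtain F where F: "finite F"
      "\<And>y. y \<in> span B \<Longrightarrow> norm y \<le> \<bar>r\<bar> + \<bar>r\<bar> / d * norm b \<Longrightarrow> \<exists>x\<in>F. dist y x < e / 2"
      using insert.IH[of "e / 2" "\<bar>r\<bar> + \<bar>r\<bar> / d * norm b"] insert.prems by auto
    have "\<exists>x\<in>(\<lambda>(u, v). u + v) ` (G \<times> F). dist y x < e"
      if y: "y \<in> span (insert b B)" "norm y \<le> r" for y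
    proof -
      obtain k where k: "y - k *\<^sub>R b \<in> span B" using y span_breakdown_eq by blast
      have "\<bar>k\<bar> * d \<le> norm y"
      proof (cases "k = 0")
        case False
        have "(- inverse k) *\<^sub>R (y - k *\<^sub>R b) \<in> span B" using k by (intro span_scale)
        then have "d \<le> dist b ((- inverse k) *\<^sub>R (y - k *\<^sub>R b))"
          unfolding d_def by (rule infdist_le)
        also have "\<dots> = norm (inverse k *\<^sub>R y)"
          using False by (simp add: dist_norm algebra_simps)
        finally show ?thesis using False by (simp add: field_simps)
      qed simp
      then have kb: "\<bar>k\<bar> \<le> \<bar>r\<bar> / d" using d y by (simp add: field_simps)
      then have "k *\<^sub>R b \<in> ?S" by (intro imageI) auto
      then obtain u where u: "u \<in> G" "dist u (k *\<^sub>R b) < e / 2" using G by auto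
      have "norm (y - k *\<^sub>R b) \<le> norm y + \<bar>k\<bar> * norm b"
        by (metis norm_scaleR norm_triangle_ineq4)
      also have "\<dots> \<le> \<bar>r\<bar> + \<bar>r\<bar> / d * norm b"
        using y kb by (intro add_mono mult_right_mono) auto
      finally obtain v where v: "v \<in> F" "dist (y - k *\<^sub>R b) v < e / 2" using F(2) k by blast
      have "dist y (u + v) \<le> dist (k *\<^sub>R b) u + dist (y - k *\<^sub>R b) v"
        using norm_triangle_ineq[of "k *\<^sub>R b - u" "(y - k *\<^sub>R b) - v"]
        by (simp add: dist_norm algebra_simps)
      then have "dist y (u + v) < e" using u v by (simp add: dist_commute)
      then show ?thesis using u v by force
    qed
    moreover have "finite ((\<lambda>(u, v). u + v) ` (G \<times> F))" using F G by auto
    ultimately show ?thesis by blast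
  qed
qed

section \<open>Octahedrality\<close>

text \<open>
  Let \<open>a = norm y\<close> and \<open>u = y / a\<close>. If \<open>0 \<le> t \<le> a\<close>, then \<open>y + t z\<close> differs from
  \<open>a (u + z)\<close> by a vector of norm \<open>a - t\<close>; otherwise it differs from \<open>t (u + z)\<close> by one of norm
  \<open>t - a\<close>. Either way the norm is at least \<open>a + t\<close> minus \<open>e\<close> times the larger of \<open>a\<close> and \<open>t\<close>.
  For negative \<open>t\<close> replace \<open>y\<close> by \<open>- y\<close>.
\<close>
lemma octahedral_inequality_if_unit_vectors:
  fixes z :: "'z::real_normed_vector"
  assumes Y: "subspace Y" and z: "norm z = 1" and e: "0 \<le> e"
    and unit: "\<And>y. y \<in> Y \<Longrightarrow> norm y = 1 \<Longrightarrow> 2 - e \<le> norm (y + z)"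
    and y: "y \<in> Y"
  shows "(1 - e) * (norm y + \<bar>t\<bar>) \<le> norm (y + t *\<^sub>R z)"
proof -
  have pos: "(1 - e) * (norm y + t) \<le> norm (y + t *\<^sub>R z)" if y: "y \<in> Y" and t: "0 \<le> t" for y t
  proof (cases "y = 0")
    case True
    then show ?thesis using t e z by (simp add: mult_left_le_one_le left_diff_distrib)
  next
    case False
    define a u where "a = norm y" and "u = y /\<^sub>R norm y"
    have a: "0 < a" and yu: "y = a *\<^sub>R u" and nu: "norm u = 1"
      using False by (auto simp: a_def u_def)
    have "u \<in> Y" using Y y by (simp add: u_def subspace_scale)
    then have uz: "2 - e \<le> norm (u + z)" using unit nu by blast
    have "0 \<le> a * e" "0 \<le> t * e" using a t e by auto
    show ?thesis
    proof (cases "t \<le> a")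
      case True
      have "a * (2 - e) \<le> norm (a *\<^sub>R (u + z))" using uz a by simp
      also have "a *\<^sub>R (u + z) = (y + t *\<^sub>R z) + (a - t) *\<^sub>R z" by (simp add: yu algebra_simps)
      also have "norm \<dots> \<le> norm (y + t *\<^sub>R z) + (a - t)"
        using True z norm_triangle_ineq[of "y + t *\<^sub>R z" "(a - t) *\<^sub>R z"] by simp
      finally show ?thesis using \<open>0 \<le> t * e\<close> by (simp add: a_def[symmetric] algebra_simps)
    next
      case False
      have "t * (2 - e) \<le> norm (t *\<^sub>R (u + z))" using uz t by (simp add: mult_left_mono)
      also have "t *\<^sub>R (u + z) = (y + t *\<^sub>R z) + (t - a) *\<^sub>R u" by (simp add: yu algebra_simps)
      also have "norm \<dots> \<le> norm (y + t *\<^sub>R z) + (t - a)"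
        using False nu norm_triangle_ineq[of "y + t *\<^sub>R z" "(t - a) *\<^sub>R u"] by simp
      finally show ?thesis using \<open>0 \<le> a * e\<close> by (simp add: a_def[symmetric] algebra_simps)
    qed
  qed
  show ?thesis
  proof (cases "0 \<le> t")
    case True
    then show ?thesis using pos[OF y] by simp
  next
    case False
    have "norm (- y + (- t) *\<^sub>R z) = norm (y + t *\<^sub>R z)"
      by (metis add.commute minus_add_distrib norm_minus_cancel scaleR_minus_left)
    then show ?thesis using pos[of "- y" "- t"] Y y False by (simp add: subspace_neg)
  qed
qed

text \<open>
  A point \<open>d\<close> within \<open>\<delta>\<close> of a unit vector \<open>y\<close> has norm within \<open>\<delta>\<close> of 1, so its normalization is
  within \<open>2 * \<delta>\<close> of \<open>y\<close>. A direction with error \<open>\<delta>\<close> at the normalized points then has error at most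
  \<open>3 * \<delta>\<close> at \<open>y\<close>, which explains the factor 3; the cap at 1 keeps the points \<open>d\<close> nonzero.
\<close>
lemma octahedral_inequality_if_net:
  fixes Y :: "'z::real_normed_vector set"
  assumes H: "additive_direction_lt \<kappa> (UNIV :: 'z set)"
    and Y: "subspace Y" and e: "0 < e" and \<delta>: "\<delta> = min e 1 / 3"
    and D: "|D| <o \<kappa>" "\<And>y. y \<in> Y \<Longrightarrow> norm y = 1 \<Longrightarrow> \<exists>d\<in>D. dist y d < \<delta>"
  shows "\<exists>z\<in>sphere 0 1. \<forall>y\<in>Y. \<forall>t. (1 - e) * (norm y + \<bar>t\<bar>) \<le> norm (y + t *\<^sub>R z)"
proof -
  have \<delta>: "0 < \<delta>" "\<delta> < 1" "3 * \<delta> \<le> e" using e \<delta> by auto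
  let ?A = "sgn ` (D - {0})"
  have "|?A| \<le>o |D|"
    using card_of_image[of sgn "D - {0}"] card_of_mono1[of "D - {0}" D] ordLeq_transitive by blast
  then have "|?A| <o \<kappa>" using D(1) ordLeq_ordLess_trans by blast
  moreover have "?A \<subseteq> sphere 0 1 \<inter> UNIV" by (auto simp: norm_sgn split: if_splits)
  ultimately obtain z where z: "z \<in> sphere 0 1" "\<And>x. x \<in> ?A \<Longrightarrow> 2 - \<delta> \<le> norm (x + z)"
    using H \<delta>(1) unfolding additive_direction_lt_def by meson
  have "2 - e \<le> norm (y + z)" if y: "y \<in> Y" "norm y = 1" for y
  proof -
    obtain d where d: "d \<in> D" "norm (y - d) < \<delta>" using D(2) y by (auto simp: dist_norm)
    have close: "\<bar>1 - norm d\<bar> < \<delta>" using d y norm_triangle_ineq3[of y d] by simp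
    then have d0: "d \<noteq> 0" using \<delta> by auto
    have "d - sgn d = (1 - inverse (norm d)) *\<^sub>R d" by (simp add: sgn_div_norm algebra_simps)
    then have "norm (d - sgn d) = \<bar>(1 - inverse (norm d)) * norm d\<bar>" by (simp add: abs_mult)
    also have "\<dots> < \<delta>" using close d0 by (simp add: algebra_simps abs_minus_commute)
    finally have "norm (d - sgn d) < \<delta>" .
    then have "norm (sgn d - y) < 2 * \<delta>"
      using d norm_triangle_ineq[of "sgn d - d" "d - y"] by (simp add: norm_minus_commute)
    moreover have "2 - \<delta> \<le> norm (sgn d + z)" using z d d0 by auto
    moreover have "norm (sgn d + z) \<le> norm (sgn d - y) + norm (y + z)"
      using norm_triangle_ineq[of "sgn d - y" "y + z"] by simp
    ultimately show ?thesis using \<delta> by simp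
  qed
  then show ?thesis
    using z(1) Y e octahedral_inequality_if_unit_vectors[of Y z e] by (intro bexI[of _ z]) auto
qed

text \<open>
  Uncountable \<open>\<kappa>\<close> and \<open>\<kappa> = \<omega>\<close> differ only in how a small subspace is produced from a small set
  and a small approximating set from a small subspace.
\<close>
lemma octahedral_lt_iff:
  fixes \<kappa> :: "'k rel"
  assumes \<kappa>: "Card_order \<kappa>" "infinite (Field \<kappa>)"
  shows "octahedral_lt \<kappa> TYPE('z::real_normed_vector) \<longleftrightarrow> additive_direction_lt \<kappa> (UNIV :: 'z set)"
proof -
  have natLeq_\<kappa>: "natLeq \<le>o \<kappa>"
    using \<kappa> infinite_iff_natLeq_ordLeq card_of_Field_ordIso ordLeq_ordIso_trans by blast
  show ?thesis
  proof
    assume O: "octahedral_lt \<kappa> TYPE('z)"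
    show "additive_direction_lt \<kappa> (UNIV :: 'z set)"
      unfolding additive_direction_lt_def
    proof (intro allI impI)
      fix A :: "'z set" and e :: real
      assume A: "A \<subseteq> sphere 0 1 \<inter> UNIV" "|A| <o \<kappa>" and e: "0 < e"
      have small: "if natLeq <o \<kappa> then density_character (span A) <o \<kappa> else finite_dim (span A)"
      proof (cases "natLeq <o \<kappa>")
        case True
        then show ?thesis using density_character_span_ordLess \<kappa> A by auto
      next
        case False
        then have "natLeq =o \<kappa>" using natLeq_\<kappa> ordLeq_iff_ordLess_or_ordIso by blast
        then have "|A| <o natLeq" using ordLess_ordIso_trans[OF A(2) ordIso_symmetric] by blast
        then have "finite A" by (simp add: finite_iff_ordLess_natLeq)
        then show ?thesis using False by (auto simp: finite_dim_def)
      qed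
      obtain z where z: "z \<in> sphere 0 1"
        "\<And>y t. y \<in> span A \<Longrightarrow> (1 - e / 2) * (norm y + \<bar>t\<bar>) \<le> norm (y + t *\<^sub>R z)"
        using O small e unfolding octahedral_lt_def by (meson half_gt_zero subspace_span)
      have "2 - e \<le> norm (x + z)" if "x \<in> A" for x
      proof -
        have "norm x = 1" using that A by auto
        then show ?thesis using z(2)[of x 1] span_base[OF that] by (simp add: algebra_simps)
      qed
      then show "\<exists>z\<in>sphere 0 1. \<forall>x\<in>A. 2 - e \<le> norm (x + z)" using z by blast
    qed
  next
    assume H: "additive_direction_lt \<kappa> (UNIV :: 'z set)"
    show "octahedral_lt \<kappa> TYPE('z)"
      unfolding octahedral_lt_def
    proof (intro allI impI)
      fix Y :: "'z set" and e :: real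
      assume Y: "subspace Y" and e: "0 < e"
        and small: "if natLeq <o \<kappa> then density_character Y <o \<kappa> else finite_dim Y"
      define \<delta> where "\<delta> = min e 1 / 3"
      have "0 < \<delta>" using e by (simp add: \<delta>_def)
      have "\<exists>D. |D| <o \<kappa> \<and> (\<forall>y\<in>Y. norm y = 1 \<longrightarrow> (\<exists>d\<in>D. dist y d < \<delta>))"
      proof (cases "natLeq <o \<kappa>")
        case True
        then obtain D where D: "Y \<subseteq> closure D" "|D| <o \<kappa>"
          using small by (auto simp: density_character_ordLess_iff dense_subset_def)
        then show ?thesis
          using \<open>0 < \<delta>\<close> by (intro exI[of _ D]) (metis closure_approachable dist_commute subsetD)
      next
        case False
        then obtain B where B: "finite B" "span B = Y" using small by (auto simp: finite_dim_def)
        obtain F where F: "finite F" "\<forall>y\<in>span B. norm y \<le> 1 \<longrightarrow> (\<exists>x\<in>F. dist y x < \<delta>)"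
          using totally_bounded_cball_Int_span[OF B(1) \<open>0 < \<delta>\<close>] by blast
        have "|F| <o \<kappa>"
          using F(1) natLeq_\<kappa> finite_iff_ordLess_natLeq ordLess_ordLeq_trans by blast
        then show ?thesis using F B by (intro exI[of _ F]) auto
      qed
      then show "\<exists>z\<in>sphere 0 1. \<forall>y\<in>Y. \<forall>t. (1 - e) * (norm y + \<bar>t\<bar>) \<le> norm (y + t *\<^sub>R z)"
        using octahedral_inequality_if_net[OF H Y e \<delta>_def] by blast
    qed
  qed
qed

text \<open>
  The embedding is isometric, so it carries sets of unit vectors of \<open>X\<close> to sets of unit vectors of its
  image, and a right inverse carries them back; neither image increases the cardinality.
\<close>
lemma additive_direction_lt_range_canonical_embedding:
  "additive_direction_lt \<kappa> (range (canonical_embedding :: 'a::real_normed_vector \<Rightarrow> _)) \<longleftrightarrow>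
    (\<forall>A e. A \<subseteq> sphere (0::'a) 1 \<longrightarrow> |A| <o \<kappa> \<longrightarrow> 0 < e \<longrightarrow>
      (\<exists>z\<in>sphere 0 1. \<forall>x\<in>A. 2 - e \<le> norm (canonical_embedding x + z)))"
  (is "?L \<longleftrightarrow> ?R")
proof
  assume L: ?L
  show ?R
  proof (intro allI impI)
    fix A :: "'a set" and e :: real
    assume A: "A \<subseteq> sphere 0 1" "|A| <o \<kappa>" "0 < e"
    have "canonical_embedding ` A \<subseteq> sphere 0 1 \<inter> range canonical_embedding" using A(1) by auto
    moreover have "|canonical_embedding ` A| <o \<kappa>"
      using A(2) card_of_image ordLeq_ordLess_trans by blast
    ultimately show "\<exists>z\<in>sphere 0 1. \<forall>x\<in>A. 2 - e \<le> norm (canonical_embedding x + z)"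
      using L A(3) unfolding additive_direction_lt_def by (metis imageI)
  qed
next
  assume R: ?R
  show ?L
    unfolding additive_direction_lt_def
  proof (intro allI impI)
    fix A :: "(('a \<Rightarrow>\<^sub>L real) \<Rightarrow>\<^sub>L real) set" and e :: real
    assume A: "A \<subseteq> sphere 0 1 \<inter> range canonical_embedding" "|A| <o \<kappa>" "0 < e"
    let ?j = "inv (canonical_embedding :: 'a \<Rightarrow> _)"
    have j: "canonical_embedding (?j x) = x" if "x \<in> A" for x
      using A(1) that by (intro f_inv_into_f) auto
    have "norm (?j x) = 1" if "x \<in> A" for x
      using j[OF that] A(1) that by (metis IntD1 mem_sphere_0 norm_canonical_embedding subsetD)
    then have "?j ` A \<subseteq> sphere 0 1" by auto
    moreover have "|?j ` A| <o \<kappa>"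
      using A(2) card_of_image ordLeq_ordLess_trans by blast
    ultimately obtain z where "z \<in> sphere 0 1"
      "\<forall>x\<in>?j ` A. 2 - e \<le> norm (canonical_embedding x + z)"
      using R A(3) by meson
    then show "\<exists>z\<in>sphere 0 1. \<forall>x\<in>A. 2 - e \<le> norm (x + z)"
      using j by (intro bexI[of _ z]) auto
  qed
qed

theorem theorem3p2:
  fixes \<kappa> :: "'k rel"
  assumes "\<not> finite_dim (UNIV :: 'a::banach set)"
    and "Card_order \<kappa>" and "infinite (Field \<kappa>)"
  shows
    "(SD2P_lt \<kappa> TYPE('a) \<longleftrightarrow> octahedral_lt \<kappa> TYPE('a \<Rightarrow>\<^sub>L real)) \<and>
     (dual_weak_star_SD2P_lt \<kappa> TYPE('a) \<longleftrightarrow>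
       (\<forall>A e. A \<subseteq> sphere (0::'a) 1 \<longrightarrow> card_of A <o \<kappa> \<longrightarrow> e > 0 \<longrightarrow>
         (\<exists>z :: ('a \<Rightarrow>\<^sub>L real) \<Rightarrow>\<^sub>L real. z \<in> sphere 0 1 \<and>
           (\<forall>x\<in>A. norm (canonical_embedding x + z) \<ge> 2 - e))))"
proof
  show "SD2P_lt \<kappa> TYPE('a) \<longleftrightarrow> octahedral_lt \<kappa> TYPE('a \<Rightarrow>\<^sub>L real)"
    using assms(2,3) by (simp add: SD2P_lt_def couple_SD2P_lt_iff octahedral_lt_iff)
  show "dual_weak_star_SD2P_lt \<kappa> TYPE('a) \<longleftrightarrow>
       (\<forall>A e. A \<subseteq> sphere (0::'a) 1 \<longrightarrow> card_of A <o \<kappa> \<longrightarrow> e > 0 \<longrightarrow>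
         (\<exists>z :: ('a \<Rightarrow>\<^sub>L real) \<Rightarrow>\<^sub>L real. z \<in> sphere 0 1 \<and>
           (\<forall>x\<in>A. norm (canonical_embedding x + z) \<ge> 2 - e)))"
    unfolding dual_weak_star_SD2P_lt_def couple_SD2P_lt_iff
      additive_direction_lt_range_canonical_embedding Bex_def ..
qed

end
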